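(* Let $G=(V,E)$ be an undirected graph equipped with a cellular sheaf $\mathcal{F}$, which assigns finite-dimensional real inner product spaces $\mathcal{F}(x)$ to vertices $x\in V$ and $\mathcal{F}(e)$ to edges $e\in E$, and linear maps $\mathcal{F}_{x\trianglelefteq e}:\mathcal{F}(x)\to\mathcal{F}(e)$ for each vertex $x\in e$. Let $G'=(V,E')$ be the bidirected graph with $E'=\{(x,y),(y,x)\mid \{x,y\}\in E\}$. Then for each edge $e=\{x,y\}\in E$, the sheaf neural network message passing map from $y$ to $x$, namely the composition $$\mathcal{F}_{x\trianglelefteq e}^{\top}\circ\mathcal{F}_{y\trianglelefteq e}:\mathcal{F}(y)\to\mathcal{F}(x),$$ can be realized as a single morphism $\rho_{y\to x}:\mathcal{F}(y)\to\mathcal{F}(x)$ in a copresheaf on $G'$ (with vertex spaces $\mathcal{F}(x)$, $x\in V$), by setting $\rho_{y\to x}=\mathcal{F}_{x\trianglelefteq e}^{\top}\circ\mathcal{F}_{y\trianglelefteq e}$.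
   Context: Edges of the undirected graph $G$ are two-element sets $e=\{x,y\}$ of vertices. A cellular sheaf on an undirected graph $G=(V,E)$ consists of a real vector space $\mathcal{F}(x)$ for each $x\in V$, a real vector space $\mathcal{F}(e)$ for each $e\in E$, and a linear restriction map $\mathcal{F}_{x\trianglelefteq e}:\mathcal{F}(x)\to\mathcal{F}(e)$ for each incidence $x\trianglelefteq e$ (meaning $x\in e$). The symbol $^\top$ denotes the adjoint with respect to the given inner products, so $\mathcal{F}_{x\trianglelefteq e}^{\top}:\mathcal{F}(e)\to\mathcal{F}(x)$. A copresheaf on a directed graph $G'=(V,E')$ consists of a real vector space for every vertex of $V$ and, for every directed edge $y\to x$ in $E'$, a linear map $\rho_{y\to x}$ from the space at $y$ to the space at $x$ (no further compatibility conditions are imposed). The directed edge $y\to x$ is the pair $(y,x)$. In sheaf neural network message passing along $e=\{x,y\}$, a feature vector $\mathbf{h}_y\in\mathcal{F}(y)$ is sent to $x$ as the message $\mathcal{F}_{x\trianglelefteq e}^{\top}(\mathcal{F}_{y\trianglelefteq e}(\mathbf{h}_y))\in\mathcal{F}(x)$. In copresheaf message passing, the message is $\rho_{y\to x}(\mathbf{h}_y)$. *)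

theory Defs
  imports "HOL-Analysis.Analysis" "Graph_Theory.Pair_Digraph"
begin

text \<open>
  The vector spaces attached to the vertices (edges) are arbitrary linear subspaces of one ambient
  space of type \<open>'a\<close> (\<open>'b\<close>), which may be infinite-dimensional, so the dimensions are free to vary
  from vertex to vertex (edge to edge) and need not be bounded. When the ambient space is an inner
  product space, each subspace carries the restricted inner product. No generality is lost: a family
  of inner product spaces embeds isometrically into its orthogonal direct sum.
\<close>

definition finite_dim :: "'a::real_vector set \<Rightarrow> bool" where
  "finite_dim S \<longleftrightarrow> (\<exists>B. finite B \<and> S = span B)"

text \<open>Maps between subspaces are extensional (\<open>undefined\<close> off the domain), so that equality of
  functions is equality of maps on the domain.\<close>

definition linear_map_on ::
  "'a::real_vector set \<Rightarrow> 'b::real_vector set \<Rightarrow> ('a \<Rightarrow> 'b) \<Rightarrow> bool" where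
  "linear_map_on U W f \<longleftrightarrow>
     f \<in> U \<rightarrow>\<^sub>E W \<and>
     (\<forall>u\<in>U. \<forall>v\<in>U. f (u + v) = f u + f v) \<and>
     (\<forall>c. \<forall>u\<in>U. f (c *\<^sub>R u) = c *\<^sub>R f u)"

text \<open>Relative version of \<^const>\<open>adjoint\<close>, for a map from the subspace \<open>U\<close> to the subspace \<open>W\<close>.\<close>

definition adjoint_on ::
  "'a::real_inner set \<Rightarrow> 'b::real_inner set \<Rightarrow> ('a \<Rightarrow> 'b) \<Rightarrow> 'b \<Rightarrow> 'a" where
  "adjoint_on U W f = (THE g. g \<in> W \<rightarrow>\<^sub>E U \<and> (\<forall>u\<in>U. \<forall>w\<in>W. f u \<bullet> w = u \<bullet> g w))"

locale undirected_graph =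
  fixes V :: "'v set" and E :: "'v set set"
  assumes edge_subset: "e \<in> E \<Longrightarrow> e \<subseteq> V"
    and edge_card: "e \<in> E \<Longrightarrow> card e = 2"

definition bidirected :: "'v set \<Rightarrow> 'v set set \<Rightarrow> 'v pair_pre_digraph" where
  "bidirected V E =
     \<lparr> pverts = V, parcs = {(x, y) | x y. {x, y} \<in> E} \<union> {(y, x) | x y. {x, y} \<in> E} \<rparr>"

locale cellular_sheaf = undirected_graph V E
  for V :: "'v set" and E :: "'v set set" +
  fixes Fv :: "'v \<Rightarrow> 'a::real_vector set"
    and Fe :: "'v set \<Rightarrow> 'b::real_vector set"
    and res :: "'v \<Rightarrow> 'v set \<Rightarrow> 'a \<Rightarrow> 'b"
  assumes vertex_space: "x \<in> V \<Longrightarrow> subspace (Fv x)"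
    and edge_space: "e \<in> E \<Longrightarrow> subspace (Fe e)"
    and restriction_linear: "e \<in> E \<Longrightarrow> x \<in> e \<Longrightarrow> linear_map_on (Fv x) (Fe e) (res x e)"

text \<open>The arc \<open>(y, x)\<close> is directed from \<open>y\<close> to \<open>x\<close>.\<close>

locale copresheaf = pair_wf_digraph D
  for D :: "'v pair_pre_digraph" +
  fixes S :: "'v \<Rightarrow> 'a::real_vector set"
    and \<rho> :: "'v \<times> 'v \<Rightarrow> 'a \<Rightarrow> 'a"
  assumes copresheaf_space: "x \<in> pverts D \<Longrightarrow> subspace (S x)"
    and morphism_linear: "(y, x) \<in> parcs D \<Longrightarrow> linear_map_on (S y) (S x) (\<rho> (y, x))"

text \<open>The message passing map from \<open>y\<close> to \<open>x\<close> along the edge \<open>{x, y}\<close>.\<close>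

definition sheaf_message ::
  "('v \<Rightarrow> 'a::real_inner set) \<Rightarrow> ('v set \<Rightarrow> 'b::real_inner set) \<Rightarrow>
   ('v \<Rightarrow> 'v set \<Rightarrow> 'a \<Rightarrow> 'b) \<Rightarrow> 'v \<Rightarrow> 'v \<Rightarrow> 'a \<Rightarrow> 'a" where
  "sheaf_message Fv Fe res y x =
     compose (Fv y) (adjoint_on (Fv x) (Fe {x, y}) (res x {x, y})) (res y {x, y})"

end

theory Submission
  imports Defs
begin

text \<open>
  The message passing map is a composition of linear maps, so the only point is that the adjoint
  between subspaces exists and is linear. Its existence is the Riesz representation theorem on the
  finite-dimensional domain of the restriction map; uniqueness of representing vectors then gives
  linearity.
\<close>

text \<open>Induction on the spanning set in Gram-Schmidt style: a vector representing
  \<open>\<phi>\<close> on \<open>span B\<close> is corrected by a multiple of the part of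
  \<open>b\<close> orthogonal to \<open>span B\<close>. \<open>\<phi>\<close> is generalized because
  the induction hypothesis serves two functionals.\<close>

lemma riesz_representation_span:
  fixes B :: "'a::real_inner set" and \<phi> :: "'a \<Rightarrow> real"
  assumes "finite B"
    and "\<And>u v. u \<in> span B \<Longrightarrow> v \<in> span B \<Longrightarrow> \<phi> (u + v) = \<phi> u + \<phi> v"
    and "\<And>c u. u \<in> span B \<Longrightarrow> \<phi> (c *\<^sub>R u) = c * \<phi> u"
  shows "\<exists>r\<in>span B. \<forall>u\<in>span B. \<phi> u = u \<bullet> r"
  using assms
proof (induction B arbitrary: \<phi> rule: finite_induct)
  case empty
  from empty(2)[of 0 0] show ?case by simp
next
  case (insert b B)
  have mono: "u \<in> span (insert b B)" if "u \<in> span B" for u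
    using that span_mono[of B "insert b B"] by blast
  \<comment> \<open>Representing \<open>\<lambda>u. u \<bullet> b\<close> on \<open>span B\<close>
    yields the orthogonal projection \<open>p\<close> of \<open>b\<close>.\<close>
  obtain p where p: "p \<in> span B" "\<And>u. u \<in> span B \<Longrightarrow> u \<bullet> b = u \<bullet> p"
    using insert.IH[of "\<lambda>u. u \<bullet> b"] by (auto simp: inner_add_left)
  obtain r where r: "r \<in> span B" "\<And>u. u \<in> span B \<Longrightarrow> \<phi> u = u \<bullet> r"
    using insert.IH[of \<phi>, OF insert.prems] mono by auto
  define d where "d = b - p"
  have d_span: "d \<in> span (insert b B)"
    unfolding d_def by (rule span_diff[OF span_base mono[OF p(1)]]) simp
  have d_orth: "u \<bullet> d = 0" if "u \<in> span B" for u
    using p(2)[OF that] by (simp add: d_def inner_diff_right)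
  have \<phi>_zero: "\<phi> 0 = 0"
    using insert.prems(2)[of 0 0] by (simp add: span_zero)
  \<comment> \<open>Since \<open>r\<close> is orthogonal to \<open>d\<close>, the value at
    \<open>d\<close> forces \<open>k * (d \<bullet> d) = \<phi> d\<close>.\<close>
  define k where "k = \<phi> d / (d \<bullet> d)"
  \<comment> \<open>For \<open>d = 0\<close>, i.e. \<open>b \<in> span B\<close>, both sides vanish.\<close>
  have k: "k * (d \<bullet> d) = \<phi> d"
    using \<phi>_zero by (cases "d = 0") (auto simp: k_def)
  show ?case
  proof (intro bexI ballI)
    show "r + k *\<^sub>R d \<in> span (insert b B)"
      by (intro span_add span_scale mono r(1) d_span)
  next
    fix u assume "u \<in> span (insert b B)"
    then obtain c where c: "u - c *\<^sub>R b \<in> span B"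
      by (auto simp: span_insert)
    \<comment> \<open>Replacing \<open>b\<close> by \<open>p\<close> in \<open>u\<close> leaves its
      component in \<open>span B\<close>; the remainder is \<open>c *\<^sub>R d\<close>.\<close>
    define v where "v = (u - c *\<^sub>R b) + c *\<^sub>R p"
    have v: "v \<in> span B"
      unfolding v_def by (intro span_add span_scale c p(1))
    have u: "u = v + c *\<^sub>R d"
      by (simp add: v_def d_def scaleR_diff_right)
    have "\<phi> u = v \<bullet> r + c * \<phi> d"
      using insert.prems v d_span r(2)[OF v] by (simp add: u mono span_scale)
    \<comment> \<open>The cross terms \<open>v \<bullet> d\<close> and \<open>d \<bullet> r\<close>
      vanish by orthogonality.\<close>
    also have "\<dots> = u \<bullet> (r + k *\<^sub>R d)"
      using d_orth[OF v] d_orth[OF r(1)] k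
      by (simp add: u inner_add_left inner_add_right inner_commute)
    finally show "\<phi> u = u \<bullet> (r + k *\<^sub>R d)" .
  qed
qed

lemma inner_eq_on_subspace_imp_eq:
  fixes a b :: "'a::real_inner"
  assumes "subspace U" "a \<in> U" "b \<in> U" "\<And>u. u \<in> U \<Longrightarrow> u \<bullet> a = u \<bullet> b"
  shows "a = b"
proof -
  have "(a - b) \<bullet> (a - b) = 0"
    using assms(4)[OF subspace_diff[OF assms(1-3)]] by (simp add: inner_diff_right)
  then show ?thesis by simp
qed

text \<open>\<open>adjoint_on\<close> is a definite description, so its properties follow only from
  unique existence. For each \<open>w\<close>, the value is the Riesz vector of
  \<open>\<lambda>u. f u \<bullet> w\<close>.\<close>

lemma adjoint_on_works:
  assumes U: "subspace U" "finite_dim U" and f: "linear_map_on U W f"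
  shows "adjoint_on U W f \<in> W \<rightarrow>\<^sub>E U"
    and "u \<in> U \<Longrightarrow> w \<in> W \<Longrightarrow> f u \<bullet> w = u \<bullet> adjoint_on U W f w"
proof -
  let ?P = "\<lambda>g. g \<in> W \<rightarrow>\<^sub>E U \<and> (\<forall>u\<in>U. \<forall>w\<in>W. f u \<bullet> w = u \<bullet> g w)"
  obtain B where B: "finite B" "U = span B"
    using U(2) by (auto simp: finite_dim_def)
  have "\<exists>r\<in>U. \<forall>u\<in>U. f u \<bullet> w = u \<bullet> r" for w
    using riesz_representation_span[OF B(1), of "\<lambda>u. f u \<bullet> w"] f
    by (simp add: B(2) linear_map_on_def inner_add_left)
  then obtain g where g: "\<And>w. g w \<in> U" "\<And>u w. u \<in> U \<Longrightarrow> f u \<bullet> w = u \<bullet> g w"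
    by metis
  have "\<exists>!g. ?P g"
  \<comment> \<open>The chosen \<open>g\<close> is total; restricting it to \<open>W\<close> makes
    it extensional, which uniqueness as a HOL function requires.\<close>
  proof (rule ex1I[of _ "restrict g W"])
    show "?P (restrict g W)"
      using g by auto
  next
    fix h assume h: "?P h"
    show "h = restrict g W"
    proof (rule extensionalityI[of _ W])
      fix w assume w: "w \<in> W"
      have "h w = g w"
      proof (rule inner_eq_on_subspace_imp_eq[OF U(1) _ g(1)])
        show "h w \<in> U"
          using h w by auto
        show "u \<bullet> h w = u \<bullet> g w" if "u \<in> U" for u
          using h w that g(2)[OF that, of w] by metis
      qed
      with w show "h w = restrict g W w" by simp
    qed (use h in \<open>auto simp: PiE_def\<close>)
  qed
  from theI'[OF this] have "?P (adjoint_on U W f)"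
    unfolding adjoint_on_def .
  then show "adjoint_on U W f \<in> W \<rightarrow>\<^sub>E U"
    and "u \<in> U \<Longrightarrow> w \<in> W \<Longrightarrow> f u \<bullet> w = u \<bullet> adjoint_on U W f w"
    by blast+
qed

lemma linear_map_on_adjoint_on:
  assumes U: "subspace U" "finite_dim U" and W: "subspace W" and f: "linear_map_on U W f"
  shows "linear_map_on W U (adjoint_on U W f)"
proof -
  let ?g = "adjoint_on U W f"
  note adj = adjoint_on_works[OF U f]
  have g: "?g w \<in> U" if "w \<in> W" for w
    using adj(1) that by auto
  \<comment> \<open>Both sides are tested against \<open>u \<in> U\<close>; moving \<open>?g\<close>
    back across the inner product reduces the claim to additivity in the second argument.\<close>
  have "?g (v + w) = ?g v + ?g w" if "v \<in> W" "w \<in> W" for v w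
    using that by (intro inner_eq_on_subspace_imp_eq[OF U(1)])
      (auto simp: g U(1) W subspace_add inner_add_right simp flip: adj(2))
  moreover have "?g (c *\<^sub>R w) = c *\<^sub>R ?g w" if "w \<in> W" for c w
    using that by (intro inner_eq_on_subspace_imp_eq[OF U(1)])
      (auto simp: g U(1) W subspace_scale simp flip: adj(2))
  ultimately show ?thesis
    using adj(1) by (simp add: linear_map_on_def)
qed

lemma linear_map_on_compose:
  assumes "subspace U" "linear_map_on U W f" "linear_map_on W X g"
  shows "linear_map_on U X (compose U g f)"
proof -
  have f: "f u \<in> W" if "u \<in> U" for u
    using assms(2) that by (auto simp: linear_map_on_def)
  show ?thesis
    using assms f
    by (auto simp: linear_map_on_def compose_def subspace_add subspace_scale PiE_mem)
qed

theorem theorem1: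
  fixes V :: "'v set" and E :: "'v set set"
    and Fv :: "'v \<Rightarrow> 'a::real_inner set"
    and Fe :: "'v set \<Rightarrow> 'b::real_inner set"
    and res :: "'v \<Rightarrow> 'v set \<Rightarrow> 'a \<Rightarrow> 'b"
  assumes "cellular_sheaf V E Fv Fe res"
    and "\<And>x. x \<in> V \<Longrightarrow> finite_dim (Fv x)"
    and "\<And>e. e \<in> E \<Longrightarrow> finite_dim (Fe e)"
  shows "\<exists>\<rho>. copresheaf (bidirected V E) Fv \<rho> \<and>
             (\<forall>x y. {x, y} \<in> E \<longrightarrow> \<rho> (y, x) = sheaf_message Fv Fe res y x)"
proof -
  interpret cellular_sheaf V E Fv Fe res by fact
  let ?\<rho> = "\<lambda>(y, x). sheaf_message Fv Fe res y x"
  \<comment> \<open>Both orientations in \<open>bidirected\<close> give the same condition, because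
    \<open>{x, y} = {y, x}\<close>.\<close>
  have arc: "(y, x) \<in> parcs (bidirected V E) \<longleftrightarrow> {x, y} \<in> E" for x y
    by (auto simp: bidirected_def insert_commute)
  have verts: "pverts (bidirected V E) = V"
    by (simp add: bidirected_def)
  have ends: "x \<in> V" "y \<in> V" if "{x, y} \<in> E" for x y
    using edge_subset[OF that] by auto
  have "linear_map_on (Fv y) (Fv x) (sheaf_message Fv Fe res y x)" if "{x, y} \<in> E" for x y
    unfolding sheaf_message_def using that ends[OF that] assms(2)
    by (intro linear_map_on_compose[where W = "Fe {x, y}"] linear_map_on_adjoint_on
        vertex_space edge_space restriction_linear) auto
  then have "copresheaf (bidirected V E) Fv ?\<rho>"
    \<comment> \<open>\<open>ends\<close> also discharges well-formedness of the digraph: arcs start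
      and end in \<open>V\<close>.\<close>
    by unfold_locales (auto simp: arc verts ends vertex_space)
  then show ?thesis
    by (intro exI[of _ ?\<rho>]) simp
qed

end
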